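(* Let $k\geq 3$ be an integer and define $$\mathcal{W}_k(m)=(6m+1)\prod_{i=1}^{k-2}\left(4\cdot 3^{i}m+1\right)\cdot\left(2\cdot 3^{k-1}m+1\right).$$ Then $\mathcal{W}_k(3^{k-3}M)$, as a polynomial in $M$ (written as the product of the $k$ linear factors obtained by substituting $m=3^{k-3}M$ in each of the factors above), is a polynomial producing many absolute pseudoprimes with $k$ prime factors.
   Context: $\mathbb{N}$ denotes the set of positive integers. An absolute pseudoprime (Carmichael number) is a composite positive integer $N$ such that $a^{N-1}\equiv 1 \pmod N$ for every integer $a$ prime to $N$. Definition. A polynomial $P(M)=\prod_{i=1}^{k}(\alpha_iM+1)$, a product of $k$ distinct linear polynomials with $\alpha_i\in\mathbb{N}$, is called a polynomial producing many absolute pseudoprimes with $k$ prime factors if $P(M)\equiv 1 \pmod{\alpha_iM}$ for every $M\in\mathbb{N}$ and every $1\leq i\leq k$. (For $k\ge 3$, such a $P$ has the property that $P(M)$ is an absolute pseudoprime with exactly $k$ prime factors whenever all the factors $\alpha_iM+1$ are simultaneously prime.) *)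

theory Defs
  imports "HOL-Computational_Algebra.Polynomial" "HOL-Number_Theory.Cong"
begin

text \<open>
  The linear polynomial \<open>a * M + 1\<close> is \<open>[:1, a:]\<close>. The coefficients \<open>\<alpha> i\<close> are determined by
  \<open>P\<close> up to order, as all the linear factors have constant term 1; hence this is a property of
  the polynomial \<open>P\<close> alone.
\<close>

definition produces_many_absolute_pseudoprimes :: "nat \<Rightarrow> int poly \<Rightarrow> bool" where
  "produces_many_absolute_pseudoprimes k P \<longleftrightarrow>
     (\<exists>\<alpha> :: nat \<Rightarrow> nat.
        (\<forall>i\<in>{1..k}. \<alpha> i > 0) \<and> inj_on \<alpha> {1..k} \<and>
        P = (\<Prod>i=1..k. [:1, int (\<alpha> i):]) \<and>
        (\<forall>M::nat. M > 0 \<longrightarrow> (\<forall>i\<in>{1..k}. [poly P (int M) = 1] (mod (int (\<alpha> i) * int M)))))"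

definition W :: "nat \<Rightarrow> int poly" where
  "W k = [:1, 6:] * (\<Prod>i=1..k-2. [:1, 4 * 3 ^ i:]) * [:1, 2 * 3 ^ (k - 1):]"

end

(* Put k = n + 3 and x = 2 * 3^(n+1) * M. Every linear factor of the polynomial is 1 + c x, with c
   running through 1, 2 * 3^j (j = 0..n) and 3^(n+1), and every coefficient divides 4 * 3^(2n+2).
   Modulo N = 4 * 3^(2n+2) * M we have x^2 = 0, hence the product is 1 + s x with s the sum of the c.
   The geometric sum telescopes to s = 2 * 3^(n+1), and s x = N. *)

theory Submission
  imports Defs
begin

text \<open>Only the terms of degree at most one in \<open>x\<close> survive modulo
  \<open>N\<close>; each induction step produces a single cross term, a multiple of
  \<open>x ^ 2\<close>.\<close>

lemma cong_prod_one_plus_mult: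
  fixes x N :: "'a :: unique_euclidean_ring"
  assumes "N dvd x ^ 2"
  shows "[(\<Prod>i\<in>A. 1 + c i * x) = 1 + (\<Sum>i\<in>A. c i) * x] (mod N)"
proof (induction A rule: infinite_finite_induct)
  case (insert a A)
  have "[(\<Prod>i\<in>insert a A. 1 + c i * x) = (1 + c a * x) * (1 + (\<Sum>i\<in>A. c i) * x)] (mod N)"
    using insert by (simp add: cong_mult)
  also have "(1 + c a * x) * (1 + (\<Sum>i\<in>A. c i) * x)
      = 1 + (\<Sum>i\<in>insert a A. c i) * x + c a * (\<Sum>i\<in>A. c i) * x ^ 2"
    using insert.hyps by (simp add: algebra_simps power2_eq_square)
  also have "[1 + (\<Sum>i\<in>insert a A. c i) * x + c a * (\<Sum>i\<in>A. c i) * x ^ 2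
      = 1 + (\<Sum>i\<in>insert a A. c i) * x] (mod N)"
    using assms by (simp add: cong_iff_dvd_diff)
  finally show ?case .
qed simp_all

lemma W_pcompose:
  "W k \<circ>\<^sub>p [:0, b:] =
     [:1, 6 * b:] * (\<Prod>i=1..k-2. [:1, 4 * 3 ^ i * b:]) * [:1, 2 * 3 ^ (k - 1) * b:]"
  unfolding W_def pcompose_mult pcompose_prod by (simp add: pcompose_pCons mult.commute)

text \<open>Brings a product over \<open>{1..n+3}\<close> into the shape of \<open>W\<close>, whose
  inner factors are numbered from 1.\<close>

lemma prod_split_ends:
  fixes f :: "nat \<Rightarrow> 'a :: comm_monoid_mult"
  shows "prod f {1..n+3} = f 1 * (\<Prod>i=1..n+1. f (Suc i)) * f (n + 3)"
proof -
  have "prod f {1..n+3} = f 1 * prod f {2..n+3}"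
    by (simp add: prod.atLeast_Suc_atMost numeral_2_eq_2)
  also have "prod f {2..n+3} = prod f {Suc 1..Suc (n + 1)} * f (n + 3)"
    using prod.nat_ivl_Suc'[of 2 "n + 2" f] by (simp add: numeral_2_eq_2 numeral_3_eq_3 mult.commute)
  also have "prod f {Suc 1..Suc (n + 1)} = (\<Prod>i=1..n+1. f (Suc i))"
    by (rule prod.shift_bounds_cl_Suc_ivl)
  finally show ?thesis
    by (simp add: mult.assoc)
qed

text \<open>The witness for \<alpha>, in the order of the factors of \<open>W\<close>. Position
  \<open>i\<close> between the ends holds the inner factor with index \<open>i - 1\<close>, whence
  the exponent \<open>n + (i - 1)\<close>.\<close>

definition coefficient :: "nat \<Rightarrow> nat \<Rightarrow> nat" where
  "coefficient n i =
     (if i = 1 then 2 * 3 ^ (n + 1) else if i = n + 3 then 2 * 3 ^ (2 * n + 2) else 4 * 3 ^ (n + i - 1))"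

lemma inj_on_coefficient: "inj_on (coefficient n) {1..n+3}"
proof -
  (* The two extreme coefficients are congruent to 2 modulo 4, the others to 0. *)
  have parity: "2 * 3 ^ a \<noteq> 4 * (3 ^ b :: nat)" for a b
  proof
    assume "2 * 3 ^ a = 4 * (3 ^ b :: nat)"
    then have "even (3 ^ a :: nat)"
      by simp
    then show False
      by simp
  qed
  \<comment> \<open>Within each parity class the exponents of 3 decide:
    \<open>n + 1 < 2 * n + 2\<close> at the two ends, and \<open>n + i - 1\<close> is injective in
    \<open>i\<close> between them.\<close>
  show ?thesis
    by (auto simp: inj_on_def coefficient_def parity parity[symmetric] simp del: power_Suc split: if_splits)
qed

text \<open>One congruence modulo this common multiple, times \<open>M\<close>, will serve all
  factors. The inner exponents reach at most \<open>2 * n + 1\<close>.\<close>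

lemma coefficient_dvd:
  assumes "i \<in> {1..n+3}"
  shows "coefficient n i dvd 4 * 3 ^ (2 * n + 2)"
proof -
  have "2 * 3 ^ (n + 1) dvd (4 * 3 ^ (2 * n + 2) :: nat)"
    by (intro mult_dvd_mono le_imp_power_dvd) simp_all
  moreover have "2 * 3 ^ (2 * n + 2) dvd (4 * 3 ^ (2 * n + 2) :: nat)"
    by (intro mult_dvd_mono) simp_all
  moreover have "4 * 3 ^ (n + i - 1) dvd (4 * 3 ^ (2 * n + 2) :: nat)" if "i \<noteq> n + 3"
    using assms that by (intro mult_dvd_mono le_imp_power_dvd) auto
  ultimately show ?thesis
    unfolding coefficient_def by presburger
qed

lemma W_eq_prod_coefficient:
  "W (n + 3) \<circ>\<^sub>p [:0, 3 ^ n:] = (\<Prod>i=1..n+3. [:1, int (coefficient n i):])"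
proof -
  have "(\<Prod>i=1..n+1. [:1, 4 * 3 ^ i * 3 ^ n:]) = (\<Prod>i=1..n+1. [:1, int (coefficient n (Suc i)):])"
    by (rule prod.cong) (auto simp: coefficient_def power_add)
  then show ?thesis
    unfolding W_pcompose prod_split_ends
    by (simp add: coefficient_def power_add mult_2_right mult_ac del: prod.cl_ivl_Suc)
qed

lemma poly_W_cong_1:
  "[poly (W (n + 3) \<circ>\<^sub>p [:0, 3 ^ n:]) M = 1] (mod (4 * 3 ^ (2 * n + 2) * M))"
proof -
  define x where "x = 2 * 3 ^ (n + 1) * M"
  define N where "N = 4 * 3 ^ (2 * n + 2) * M"
  \<comment> \<open>Here \<open>s\<close> sums the inner multipliers of \<open>x\<close> only. The
    outer ones are 1 and \<open>3 ^ (n + 1) = s + 1\<close>, so the full sum is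
    \<open>2 * (s + 1)\<close>.\<close>
  define s :: int where "s = (\<Sum>i=1..n+1. 2 * 3 ^ (i - 1))"
  have s: "s = 3 ^ (n + 1) - 1"
    unfolding s_def by (induction n) simp_all
  have "x ^ 2 = N * M"
    by (simp add: x_def N_def power2_eq_square power_add mult_2)
  then have dvd: "N dvd x ^ 2"
    by simp
  \<comment> \<open>As \<open>i\<close> is at least 1, one factor 3 can be moved from
    \<open>3 ^ i\<close> into \<open>x\<close>.\<close>
  have "1 + 4 * 3 ^ i * 3 ^ n * M = 1 + 2 * 3 ^ (i - 1) * x" if "i \<in> {1..n+1}" for i
    using that by (cases i) (simp_all add: x_def)
  then have "(\<Prod>i=1..n+1. 1 + 4 * 3 ^ i * 3 ^ n * M) = (\<Prod>i=1..n+1. 1 + 2 * 3 ^ (i - 1) * x)"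
    by (rule prod.cong[OF refl])
  then have inner: "[(\<Prod>i=1..n+1. 1 + 4 * 3 ^ i * 3 ^ n * M) = 1 + s * x] (mod N)"
    using cong_prod_one_plus_mult[OF dvd, of "\<lambda>i. 2 * 3 ^ (i - 1)" "{1..n+1}"]
    by (simp only: s_def)
  have "poly (W (n + 3) \<circ>\<^sub>p [:0, 3 ^ n:]) M
      = (1 + x) * (\<Prod>i=1..n+1. 1 + 4 * 3 ^ i * 3 ^ n * M) * (1 + (s + 1) * x)"
    unfolding W_pcompose poly_mult poly_prod
    by (simp add: s x_def power_add mult_ac del: prod.cl_ivl_Suc)
  also have "[(1 + x) * (\<Prod>i=1..n+1. 1 + 4 * 3 ^ i * 3 ^ n * M) * (1 + (s + 1) * x)
      = (1 + x) * (1 + s * x) * (1 + (s + 1) * x)] (mod N)"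
    by (intro cong_mult inner cong_refl)
  also have "[(1 + x) * (1 + s * x) * (1 + (s + 1) * x) = 1] (mod N)"
  proof -
    have sx: "2 * (s + 1) * x = N"
      by (simp add: s x_def N_def power_add mult_2)
    \<comment> \<open>The linear term is exactly \<open>N\<close> by \<open>sx\<close>; the
      quadratic and cubic terms are collected as a multiple of \<open>x ^ 2\<close>.\<close>
    have "(1 + x) * (1 + s * x) * (1 + (s + 1) * x) - 1
        = 2 * (s + 1) * x + x ^ 2 * (s + (s + 1) ^ 2 + s * (s + 1) * x)"
      by algebra
    then show ?thesis
      unfolding cong_iff_dvd_diff sx using dvd by simp
  qed
  finally show ?thesis
    unfolding N_def .
qed

theorem mainTheorem3:
  fixes k :: nat
  assumes "k \<ge> 3"
  shows "W k \<circ>\<^sub>p [:0, 3 ^ (k - 3):] =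
           [:1, 6 * 3 ^ (k - 3):] * (\<Prod>i=1..k-2. [:1, 4 * 3 ^ i * 3 ^ (k - 3):])
             * [:1, 2 * 3 ^ (k - 1) * 3 ^ (k - 3):]
         \<and> produces_many_absolute_pseudoprimes k (W k \<circ>\<^sub>p [:0, 3 ^ (k - 3):])"
proof
  show "W k \<circ>\<^sub>p [:0, 3 ^ (k - 3):] =
      [:1, 6 * 3 ^ (k - 3):] * (\<Prod>i=1..k-2. [:1, 4 * 3 ^ i * 3 ^ (k - 3):])
        * [:1, 2 * 3 ^ (k - 1) * 3 ^ (k - 3):]"
    by (rule W_pcompose)
  obtain n where k: "k = n + 3"
    using assms by (metis le_add_diff_inverse2)
  have "[poly (W (n + 3) \<circ>\<^sub>p [:0, 3 ^ n:]) (int M) = 1] (mod (int (coefficient n i) * int M))"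
    if "i \<in> {1..n+3}" for i M
  proof (rule cong_dvd_modulus[OF poly_W_cong_1])
    have "int (coefficient n i) dvd int (4 * 3 ^ (2 * n + 2))"
      using coefficient_dvd[OF that] by (simp only: int_dvd_int_iff)
    then show "int (coefficient n i) * int M dvd 4 * 3 ^ (2 * n + 2) * int M"
      by (intro mult_dvd_mono) simp_all
  qed
  moreover have "coefficient n i > 0" for i
    by (simp add: coefficient_def)
  ultimately show "produces_many_absolute_pseudoprimes k (W k \<circ>\<^sub>p [:0, 3 ^ (k - 3):])"
    unfolding produces_many_absolute_pseudoprimes_def k add_diff_cancel_right'
    using inj_on_coefficient W_eq_prod_coefficient by blast
qed

end
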